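(* Let $A = Q + a b^T$ for an orthogonal $n\times n$ matrix $Q$ and $a,b\in\mathbb{R}^n$. Let $\sigma_1,\ldots,\sigma_r$ be the singular values of $A$, and if $r<n$ additionally let $\sigma_n=0$. Then $$\sigma_1-\operatorname{sign}(1+a^TQb)\,\sigma_n=\|a\|\,\|b\|.$$
   Context: $\|x\|$ denotes the Euclidean norm of $x\in\mathbb{R}^n$. Matrices are real and vectors are column vectors, so $ab^T$ is the $n\times n$ outer product. The singular values $\sigma_1\ge\cdots\ge\sigma_r>0$ are the nonzero singular values of $A$ listed in decreasing order with multiplicity, $r$ being the rank of $A$. $\operatorname{sign}(t)$ is $1$ for $t>0$, $-1$ for $t<0$, and $0$ for $t=0$.
   Formalization: The formal statement assumes n ≥ 2; for n = 1 the identity fails, e.g. Q = [1], a = b = [1] gives A = [2], so the left side is 2 − 2 = 0 while ‖a‖‖b‖ = 1. *)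

theory Defs
  imports "HOL-Analysis.Analysis" "HOL-Computational_Algebra.Polynomial"
begin

definition outer_product :: "real^'n \<Rightarrow> real^'m \<Rightarrow> real^'m^'n" where
  "outer_product a b = (\<chi> i j. a $ i * b $ j)"

text \<open>The characteristic polynomial \<open>det (x I - M)\<close>, a determinant over the polynomial ring.\<close>

definition charpoly :: "real^'n^'n \<Rightarrow> real poly" where
  "charpoly M = det (mat [:0, 1:] - (\<chi> i j. [:M $ i $ j:]))"

text \<open>The nonzero singular values of \<open>A\<close> in decreasing order and with multiplicity: the square
  roots of the nonzero eigenvalues of \<open>A\<^sup>T A\<close>. As \<open>A\<^sup>T A\<close> is symmetric positive semidefinite,
  all its eigenvalues are real and nonnegative (so ``nonzero'' is ``positive''), and their algebraic
  and geometric multiplicities agree.\<close>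

definition singular_values :: "real^'n^'m \<Rightarrow> real list" where
  "singular_values A = rev (sorted_list_of_multiset
     (image_mset sqrt {# x \<in># proots (charpoly (transpose A ** A)). x > 0 #}))"

text \<open>The \<open>i\<close>-th singular value, counted from \<open>1\<close>; it is \<open>0\<close> beyond the rank.\<close>

definition singular_value :: "real^'n^'m \<Rightarrow> nat \<Rightarrow> real" where
  "singular_value A i = (if i \<le> rank A then singular_values A ! (i - 1) else 0)"

end

theory Submission
  imports Defs
begin

text \<open>
  Put \<open>c = a \<bullet> Q b\<close>, \<open>e = 1 + c\<close> and \<open>T = \<parallel>a\<parallel> \<parallel>b\<parallel>\<close>. As \<open>A\<^sup>T A\<close> is a perturbation of the identity of rank
  at most two, the matrix determinant lemma yields its characteristic polynomial
  \<open>(x - 1)\<^bsup>n-2\<^esup> (x\<^sup>2 - (2 e + T\<^sup>2) x + e\<^sup>2)\<close>. With \<open>h\<^sup>2 = T\<^sup>2 + 4 e\<close> (nonnegative by Cauchy-Schwarz), the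
  quadratic factor has the roots \<open>((h \<plusminus> T) / 2)\<^sup>2\<close>, which enclose \<open>1\<close>. So the extreme singular
  values are \<open>(h + T) / 2\<close> and \<open>\<bar>h - T\<bar> / 2\<close>, where \<open>h - T\<close> has the sign of \<open>e\<close>.
\<close>

section \<open>Determinants of low-rank perturbations\<close>

lemma matrix_mul_outer_product:
  "B ** outer_product p q = outer_product (B *v p) q"
  by (simp add: vec_eq_iff outer_product_def matrix_matrix_mult_def matrix_vector_mult_def
      sum_distrib_right mult.assoc)

lemma outer_product_matrix_mul:
  "outer_product p q ** B = outer_product p (transpose B *v q)"
  by (simp add: vec_eq_iff outer_product_def matrix_matrix_mult_def matrix_vector_mult_def
      transpose_def sum_distrib_left mult_ac)

lemma outer_product_mult_vec: "outer_product p q *v x = (q \<bullet> x) *\<^sub>R p"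
  by (simp add: vec_eq_iff outer_product_def matrix_vector_mult_def inner_vec_def
      sum_distrib_left mult_ac)

lemma outer_product_scaleR_left: "outer_product (r *\<^sub>R p) q = r *\<^sub>R outer_product p q"
  by (simp add: vec_eq_iff outer_product_def)

lemma outer_product_scaleR_right: "outer_product p (r *\<^sub>R q) = r *\<^sub>R outer_product p q"
  by (simp add: vec_eq_iff outer_product_def)

lemma outer_product_add_left: "outer_product (p + r) q = outer_product p q + outer_product r q"
  by (simp add: vec_eq_iff outer_product_def algebra_simps)

lemma outer_product_add_right: "outer_product p (q + r) = outer_product p q + outer_product p r"
  by (simp add: vec_eq_iff outer_product_def algebra_simps)

lemma matrix_add_rdistrib: "(B + C) ** D = B ** D + C ** D"
  by (simp add: vec_eq_iff matrix_matrix_mult_def distrib_right sum.distrib)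

lemma inner_transpose_mult_vec: "(transpose B *v x) \<bullet> y = x \<bullet> (B *v y)"
  for B :: "real^'n^'m"
  by (simp add: dot_lmul_matrix)

lemma orthogonal_matrix_imp_transformation:
  "orthogonal_matrix Q \<Longrightarrow> orthogonal_transformation ((*v) Q)" for Q :: "real^'n^'n"
  by (simp add: orthogonal_transformation_matrix)

lemma scaleR_eq_mat_mul: "r *\<^sub>R B = mat r ** (B :: real^'n^'m)"
  by (simp add: vec_eq_iff matrix_matrix_mult_def mat_def if_distrib[of "\<lambda>x. x * _"] cong: if_cong)

lemma det_mat: "det (mat r :: real^'n^'n) = r ^ CARD('n)"
  by (subst det_diagonal) (auto simp: mat_def)

lemma det_scaleR: "det (r *\<^sub>R B) = r ^ CARD('n) * det (B :: real^'n^'n)"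
  by (simp add: scaleR_eq_mat_mul det_mul det_mat)

text \<open>Rotating \<open>q\<close> to a multiple of a unit vector leaves a matrix that differs from the identity
  in a single column, to which Cramer's lemma applies.\<close>

lemma det_mat1_plus_outer_product:
  fixes p q :: "real^'n"
  shows "det (mat 1 + outer_product p q) = 1 + p \<bullet> q"
proof -
  fix k :: 'n
  obtain f :: "real^'n \<Rightarrow> real^'n"
    where f: "orthogonal_transformation f" "f q = norm q *\<^sub>R axis k 1"
    using orthogonal_transformation_exists[of q "norm q *\<^sub>R axis k 1"] by auto
  define R where "R = matrix f"
  have R: "orthogonal_matrix R" "\<And>x. R *v x = f x"
    using f(1) by (auto simp: R_def orthogonal_transformation_matrix matrix_works)
  have RR: "R ** transpose R = mat 1" and detR: "det R * det R = 1"
    using R(1) det_orthogonal_matrix[OF R(1)] by (auto simp: orthogonal_matrix_def)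
  have "R ** (mat 1 + outer_product p q) ** transpose R = mat 1 + outer_product (f p) (f q)"
    by (simp add: matrix_add_ldistrib matrix_add_rdistrib RR matrix_mul_outer_product
        outer_product_matrix_mul R(2))
  also have "\<dots> = (\<chi> i j. if j = k then (mat 1 *v (axis k 1 + norm q *\<^sub>R f p)) $ i else mat 1 $ i $ j)"
    unfolding matrix_vector_mul_lid by (auto simp: vec_eq_iff outer_product_def f(2) mat_def axis_def)
  finally have "det (R ** (mat 1 + outer_product p q) ** transpose R)
      = (axis k 1 + norm q *\<^sub>R f p) $ k * det (mat 1 :: real^'n^'n)"
    by (simp only: cramer_lemma)
  then have "(det R * det R) * det (mat 1 + outer_product p q) = 1 + norm q * f p $ k"
    by (simp add: det_mul mult_ac)
  moreover have "norm q * f p $ k = f p \<bullet> f q"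
    by (simp add: f(2) inner_axis)
  moreover have "f p \<bullet> f q = p \<bullet> q"
    using f(1) by (simp add: orthogonal_transformation_def)
  ultimately show ?thesis
    using detR by simp
qed

text \<open>The first two terms form a matrix \<open>D\<close> that is invertible under the
  conditions on \<open>y\<close>. Factoring it out leaves the identity plus one outer product, so
  the rank-one formula applies twice, once to \<open>D\<close> itself.\<close>

lemma det_rank_two_perturbation:
  fixes p q r w :: "real^'n"
  assumes n: "CARD('n) \<ge> 2" and y: "y \<noteq> 0" "y \<noteq> q \<bullet> p"
  shows "det (mat y - outer_product p q - outer_product r w)
    = y ^ (CARD('n) - 2) * ((y - q \<bullet> p) * (y - w \<bullet> r) - (q \<bullet> r) * (w \<bullet> p))"
proof -
  define D where "D = mat y - outer_product p q"
  \<comment> \<open>the solution of \<open>D *v z = r\<close> given by the Sherman-Morrison formula\<close>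
  define z where "z = (1 / y) *\<^sub>R (r + ((q \<bullet> r) / (y - q \<bullet> p)) *\<^sub>R p)"
  have mat_y: "mat y *v x = y *\<^sub>R x" for x :: "real^'n"
    by (simp add: vec_eq_iff mat_def matrix_vector_mult_def if_distrib[of "\<lambda>x. x * _"] cong: if_cong)
  have "D *v z = r"
  proof -
    have "q \<bullet> z = (q \<bullet> r) / (y - q \<bullet> p)"
      using y by (simp add: z_def inner_add_right field_simps)
    moreover have "y *\<^sub>R z = r + ((q \<bullet> r) / (y - q \<bullet> p)) *\<^sub>R p"
      using y by (simp add: z_def)
    ultimately show ?thesis
      by (simp add: D_def matrix_vector_mult_diff_rdistrib mat_y outer_product_mult_vec)
  qed
  then have "D - outer_product r w = D ** (mat 1 + outer_product z (- w))"
    by (simp add: matrix_add_ldistrib matrix_mul_outer_product)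
      (simp add: vec_eq_iff outer_product_def)
  then have *: "det (D - outer_product r w) = det D * (1 - w \<bullet> z)"
    by (simp add: det_mul det_mat1_plus_outer_product inner_commute)
  have "D = y *\<^sub>R (mat 1 + outer_product ((- 1 / y) *\<^sub>R p) q)"
    using y by (simp add: D_def vec_eq_iff outer_product_def mat_def right_diff_distrib)
  then have "det D = y ^ CARD('n) * (1 - (q \<bullet> p) / y)"
    by (simp only: det_scaleR det_mat1_plus_outer_product) (simp add: inner_commute)
  \<comment> \<open>Of the two split-off factors \<open>y\<close>, one clears the denominator in
    \<open>det D\<close>; the other is kept for the \<open>1 / y\<close> in
    \<open>z\<close>.\<close>
  moreover have "y ^ CARD('n) = y ^ (CARD('n) - 2) * y\<^sup>2"
    using n by (simp only: le_add_diff_inverse2 flip: power_add)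
  moreover have "y\<^sup>2 * (1 - (q \<bullet> p) / y) = y * (y - q \<bullet> p)"
    using y by (simp add: power2_eq_square field_simps)
  ultimately have detD: "det D = y ^ (CARD('n) - 2) * (y * (y - q \<bullet> p))"
    by (simp only: mult.assoc)
  have "y * (y - q \<bullet> p) * (w \<bullet> z) = (y - q \<bullet> p) * (w \<bullet> r) + (q \<bullet> r) * (w \<bullet> p)"
    using y by (simp add: z_def inner_add_right field_simps)
  then have "y * (y - q \<bullet> p) * (1 - w \<bullet> z) = (y - q \<bullet> p) * (y - w \<bullet> r) - (q \<bullet> r) * (w \<bullet> p)"
    by algebra
  then show ?thesis
    unfolding D_def[symmetric] * detD by (simp only: mult.assoc)
qed

section \<open>The characteristic polynomial of the Gram matrix\<close>

text \<open>Evaluation at \<open>x\<close> is a ring homomorphism, so it commutes with the Leibniz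
  expansion.\<close>

lemma poly_charpoly: "poly (charpoly M) x = det (mat x - M)"
proof -
  have "poly ((mat [:0, 1:] - (\<chi> i j. [:M $ i $ j:])) $ i $ j) x = (mat x - M) $ i $ j" for i j
    by (simp add: mat_def)
  then show ?thesis
    by (simp add: charpoly_def det_def poly_sum poly_prod del: vector_minus_component)
qed

text \<open>Expanding gives three outer products besides the identity; the two with left factor
  \<open>b\<close> are merged, leaving two for the rank-two formula.\<close>

lemma gram_orthogonal_plus_outer_product:
  fixes Q :: "real^'n^'n"
  assumes "orthogonal_matrix Q"
  shows "transpose (Q + outer_product a b) ** (Q + outer_product a b)
    = mat 1 + outer_product (transpose Q *v a) b
      + outer_product b (transpose Q *v a + (a \<bullet> a) *\<^sub>R b)"
proof -
  have "transpose (Q + outer_product a b) = transpose Q + outer_product b a"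
    by (simp add: vec_eq_iff transpose_def outer_product_def)
  moreover have "transpose Q ** Q = mat 1"
    using assms by (simp add: orthogonal_matrix)
  ultimately show ?thesis
    by (simp add: matrix_add_ldistrib matrix_add_rdistrib matrix_mul_outer_product
        outer_product_matrix_mul outer_product_mult_vec outer_product_add_right
        matrix_vector_mult_add_rdistrib outer_product_add_left
        outer_product_scaleR_left outer_product_scaleR_right)
qed

text \<open>Vieta's relations for \<open>l\<close> and \<open>m\<close> suffice, so no square roots
  enter here.\<close>

lemma charpoly_gram_orthogonal_plus_outer_product:
  fixes Q :: "real^'n^'n"
  assumes n: "CARD('n) \<ge> 2" and Q: "orthogonal_matrix Q"
    and A: "A = Q + outer_product a b"
    and sum: "l + m = 2 * (1 + a \<bullet> (Q *v b)) + (norm a * norm b)\<^sup>2"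
    and prod: "l * m = (1 + a \<bullet> (Q *v b))\<^sup>2"
  shows "charpoly (transpose A ** A) = [:-1, 1:] ^ (CARD('n) - 2) * ([:-l, 1:] * [:-m, 1:])"
    (is "?p = ?q")
proof (rule ccontr)
  \<comment> \<open>The determinant formula excludes two values of \<open>x\<close>, but polynomials that agree elsewhere are equal.\<close>
  assume "?p \<noteq> ?q"
  then have fin: "finite {x. poly (?p - ?q) x = 0}"
    by (intro poly_roots_finite) simp
  define u where "u = transpose Q *v a"
  define c where "c = a \<bullet> (Q *v b)"
  have bu: "b \<bullet> u = c" "u \<bullet> b = c"
    unfolding u_def c_def by (simp_all only: inner_commute[of b] inner_transpose_mult_vec)
  have uu: "u \<bullet> u = a \<bullet> a"
    using orthogonal_matrix_imp_transformation[of "transpose Q"] Q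
    by (simp only: u_def orthogonal_transformation_def orthogonal_matrix_transpose)
  have T: "(norm a * norm b)\<^sup>2 = (a \<bullet> a) * (b \<bullet> b)"
    by (simp add: power_mult_distrib power2_norm_eq_inner)
  \<comment> \<open>For \<open>y = x - 1\<close> the excluded values \<open>0\<close> and
    \<open>b \<bullet> u\<close> become \<open>1\<close> and \<open>1 + c\<close>.\<close>
  have "poly ?p x = poly ?q x" if x: "x \<noteq> 1" "x \<noteq> 1 + c" for x
  proof -
    have "mat x - transpose A ** A
        = mat (x - 1) - outer_product u b - outer_product b (u + (a \<bullet> a) *\<^sub>R b)"
      unfolding A gram_orthogonal_plus_outer_product[OF Q] u_def
      by (simp add: vec_eq_iff mat_def)
    then have "poly ?p x = (x - 1) ^ (CARD('n) - 2) * ((x - 1 - c) * (x - 1 - (c + (a \<bullet> a) * (b \<bullet> b)))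
        - (b \<bullet> b) * (a \<bullet> a + (a \<bullet> a) * c))"
      using det_rank_two_perturbation[OF n, of "x - 1" b u b "u + (a \<bullet> a) *\<^sub>R b"] x
      by (simp add: poly_charpoly bu uu inner_add_left)
    also have "(x - 1 - c) * (x - 1 - (c + (a \<bullet> a) * (b \<bullet> b))) - (b \<bullet> b) * (a \<bullet> a + (a \<bullet> a) * c)
        = (x - l) * (x - m)"
      using sum prod unfolding T c_def[symmetric] by algebra
    also have "(x - 1) ^ (CARD('n) - 2) * \<dots> = poly ?q x"
      by (simp only: poly_mult poly_power) simp
    finally show ?thesis .
  qed
  then have "UNIV - {1, 1 + c} \<subseteq> {x. poly (?p - ?q) x = 0}"
    by auto
  then have "finite (UNIV - {1, 1 + c})"
    using fin by (rule finite_subset)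
  then show False
    by (simp add: infinite_UNIV_char_0)
qed

section \<open>The extreme singular values\<close>

lemma filter_replicate_mset:
  "filter_mset P (replicate_mset k x) = (if P x then replicate_mset k x else {#})"
  by (induction k) auto

text \<open>A sorted list is determined by its multiset.\<close>

lemma singular_values_eqI:
  assumes "mset xs = image_mset sqrt {# x \<in># proots (charpoly (transpose A ** A)). x > 0 #}"
    and "sorted (rev xs)"
  shows "singular_values A = xs"
proof -
  have "sorted_list_of_multiset (mset xs) = rev xs"
    using assms(2) by (metis mset_rev sorted_list_of_multiset_mset sorted_sort_id)
  then show ?thesis
    by (simp add: singular_values_def flip: assms(1))
qed

theorem theorem1:
  fixes A Q :: "real^'n^'n" and a b :: "real^'n"
  assumes "CARD('n) \<ge> 2"
    and "orthogonal_matrix Q"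
    and "A = Q + outer_product a b"
  shows "singular_value A 1 - sgn (1 + a \<bullet> (Q *v b)) * singular_value A (CARD('n))
           = norm a * norm b"
proof -
  define T where "T = norm a * norm b"
  define e where "e = 1 + a \<bullet> (Q *v b)"
  define h where "h = sqrt (T\<^sup>2 + 4 * e)"
  define s where "s = (h + T) / 2"
  define t where "t = \<bar>h - T\<bar> / 2"
  have "\<bar>a \<bullet> (Q *v b)\<bar> \<le> T"
    using Cauchy_Schwarz_ineq2[of a "Q *v b"] assms(2)
    by (simp add: T_def orthogonal_transformation_norm orthogonal_matrix_imp_transformation)
  then have e: "1 - T \<le> e" "e \<le> 1 + T" and T: "T \<ge> 0"
    by (auto simp: e_def T_def)
  \<comment> \<open>Here \<open>T\<^sup>2 + 4 * (1 - T)\<close> and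
    \<open>T\<^sup>2 + 4 * (1 + T)\<close> are the squares of \<open>2 - T\<close> and
    \<open>2 + T\<close>, so the bounds on \<open>e\<close> become bounds on
    \<open>h\<close>.\<close>
  have "(2 - T)\<^sup>2 \<le> T\<^sup>2 + 4 * e"
    using e by (simp add: power2_eq_square algebra_simps)
  then have h2: "h\<^sup>2 = T\<^sup>2 + 4 * e" and h_ge: "\<bar>2 - T\<bar> \<le> h" and h0: "h \<ge> 0"
    unfolding h_def using real_le_rsqrt[of "\<bar>2 - T\<bar>"] by (auto intro: order_trans[OF zero_le_power2])
  have "T\<^sup>2 + 4 * e \<le> (2 + T)\<^sup>2"
    using e by (simp add: power2_eq_square algebra_simps)
  then have h_le: "h \<le> 2 + T"
    unfolding h_def using T by (intro real_le_lsqrt) auto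
  have s1: "s \<ge> 1" and t01: "t \<ge> 0" "t \<le> 1"
    using h_ge h_le by (auto simp: s_def t_def)
  have "s * t = \<bar>(h + T) * (h - T)\<bar> / 4"
    using h0 T by (simp add: s_def t_def abs_mult)
  also have "(h + T) * (h - T) = 4 * e"
    using h2 by (simp add: power2_eq_square algebra_simps)
  finally have st: "s * t = \<bar>e\<bar>"
    by simp
  have "s\<^sup>2 + t\<^sup>2 = (h\<^sup>2 + T\<^sup>2) / 2"
    by (simp add: s_def t_def power2_eq_square algebra_simps add_divide_distrib diff_divide_distrib)
  then have sum: "s\<^sup>2 + t\<^sup>2 = 2 * e + T\<^sup>2"
    by (simp add: h2)
  have prod: "s\<^sup>2 * t\<^sup>2 = e\<^sup>2"
    by (simp add: st flip: power_mult_distrib)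
  have char: "charpoly (transpose A ** A)
      = [:-1, 1:] ^ (CARD('n) - 2) * ([:-s\<^sup>2, 1:] * [:-t\<^sup>2, 1:])"
    using charpoly_gram_orthogonal_plus_outer_product[OF assms] sum prod
    unfolding e_def T_def by blast
  have t_pos: "t > 0 \<longleftrightarrow> e \<noteq> 0"
    using st s1 t01 by (auto simp: less_le)
  \<comment> \<open>Only positive singular values are listed, so \<open>t\<close> is left out when
    it vanishes.\<close>
  define xs where "xs = s # replicate (CARD('n) - 2) 1 @ (if e = 0 then [] else [t])"
  have roots: "proots (charpoly (transpose A ** A)) = replicate_mset (CARD('n) - 2) 1 + {#s\<^sup>2, t\<^sup>2#}"
    unfolding char
    by (simp only: proots_mult proots_power proots_linear_factor mult_eq_0_iff power_eq_0_iff
        pCons_eq_0_iff one_neq_zero simp_thms) simp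
  have sv: "singular_values A = xs"
  proof (intro singular_values_eqI)
    show "mset xs = image_mset sqrt {#x \<in># proots (charpoly (transpose A ** A)). x > 0#}"
    proof (cases "e = 0")
      case True
      then have "t = 0"
        using t_pos t01 by simp
      with True show ?thesis
        using s1 by (simp add: roots xs_def filter_replicate_mset)
    next
      case False
      then show ?thesis
        using s1 t_pos by (simp add: roots xs_def filter_replicate_mset)
    qed
    show "sorted (rev xs)"
      using s1 t01 by (simp add: xs_def sorted_append)
  qed
  \<comment> \<open>At rank 0 the default value 0 would apply. But then the Gram matrix vanishes and
    its only eigenvalue is 0, whereas \<open>s\<^sup>2\<close> is a positive one.\<close>
  have "rank A \<noteq> 0"
  proof
    assume "rank A = 0"
    then have "transpose A ** A = 0"
      by (simp add: rank_eq_0)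
    then have "poly (charpoly (transpose A ** A)) (s\<^sup>2) = (s\<^sup>2) ^ CARD('n)"
      by (simp add: poly_charpoly det_mat)
    moreover have "poly (charpoly (transpose A ** A)) (s\<^sup>2) = 0"
      unfolding char by (simp only: poly_mult) simp
    ultimately show False
      using s1 by simp
  qed
  then have first: "singular_value A 1 = s"
    by (simp add: singular_value_def sv xs_def)
  \<comment> \<open>Factoring out \<open>Q\<close> gives \<open>det A\<close> as \<open>e\<close> up
    to sign, so index \<open>n\<close> lies within the rank exactly when \<open>e\<close> is
    nonzero; otherwise the sign removes the last term.\<close>
  have "A = Q ** (mat 1 + outer_product (transpose Q *v a) b)"
    using assms(2) unfolding assms(3)
    by (simp add: matrix_add_ldistrib matrix_mul_outer_product matrix_vector_mul_assoc
        orthogonal_matrix_def del: transpose_matrix_vector)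
  then have "det A = det Q * e"
    by (simp add: det_mul det_mat1_plus_outer_product e_def inner_transpose_mult_vec
        del: transpose_matrix_vector)
  then have "e \<noteq> 0 \<longleftrightarrow> CARD('n) \<le> rank A"
    using det_orthogonal_matrix[OF assms(2)] det_eq_0_rank[of A] by auto
  then have last: "singular_value A (CARD('n)) = t" if "e \<noteq> 0"
    using that assms(1) by (auto simp: singular_value_def sv xs_def nth_append nth_Cons')
  \<comment> \<open>Since \<open>h + T = 2 * s\<close> is positive, \<open>e\<close> and
    \<open>h - T\<close> have equal signs; multiplying by \<open>sgn e\<close> thus undoes the
    absolute value in \<open>t\<close>.\<close>
  have "sgn (4 * e) = sgn (h - T)"
    using s1 by (simp only: sgn_mult s_def flip: \<open>(h + T) * (h - T) = 4 * e\<close>) simp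
  then have "sgn e * t = (h - T) / 2"
    by (simp add: sgn_mult t_def sgn_mult_abs)
  then have "s - sgn e * t = T"
    by (simp add: s_def field_simps)
  then show ?thesis
    using first last unfolding e_def[symmetric] T_def[symmetric] by (cases "e = 0") simp_all
qed

end
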